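(* For all integers $n,k\ge0$ and all $x\in\mathbb{Z}_p$, $$B_{k,n}(x,q)=\binom{n}{k}[x]_q^k\,[1-x]_{1/q}^{\,n-k}=\sum_{m=k}^{n}(q-1)^{-k+m}\binom{n}{m}_q S_{1,q}(m,k)\,[x]_q^k\,[1-x]_{1/q}^{\,n-k}.$$
   Context: Let $p$ be a fixed prime, $\mathbb{Z}_p$ the $p$-adic integers, and $\mathbb{C}_p$ the completion of an algebraic closure of $\mathbb{Q}_p$, with $|p|_p=1/p$. Let $q\in\mathbb{C}_p$ with $|1-q|_p<1$, $q$ not a root of unity (in particular $q\neq1$). For $x\in\mathbb{Z}_p$, $q^x$ denotes the continuous extension of $m\mapsto q^m$, and $[x]_q=\frac{1-q^x}{1-q}$, $[x]_{1/q}=\frac{1-q^{-x}}{1-q^{-1}}$. Kim's $q$-Bernstein polynomials on $\mathbb{Z}_p$: $B_{k,n}(x,q)=\binom{n}{k}[x]_q^k\,[1-x]_{1/q}^{\,n-k}$, where $\binom nk$ is the ordinary binomial coefficient; for $k>n$ this is $0$ and the sum over $k\le m\le n$ is empty. The $q$-binomial coefficient is $\binom{n}{m}_q=\frac{[n]_q!}{[n-m]_q!\,[m]_q!}$ for $0\le m\le n$, with $[m]_q!=[m]_q[m-1]_q\cdots[1]_q$, $[0]_q!=1$. The $q$-Stirling numbers of the first kind $S_{1,q}(n,k)$ ($0\le k\le n$) are defined by $q^{\binom{n}{2}}[x]_{n,q}=\sum_{k=0}^{n}S_{1,q}(n,k)[x]_q^k$, where $[x]_{n,q}=[x]_q[x-1]_q\cdots[x-n+1]_q$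 (and $[x]_{0,q}=1$); equivalently, by the polynomial identity $\prod_{j=0}^{n-1}(X-[j]_q)=\sum_{k=0}^nS_{1,q}(n,k)X^k$. *)

theory Defs
  imports
    "HOL-Analysis.Elementary_Metric_Spaces"
    "HOL-Computational_Algebra.Polynomial"
    "HOL-Computational_Algebra.Primes"
begin

text \<open>
  The library has no \<open>p\<close>-adic numbers. Inside a complete valued field of characteristic 0,
  the completion of the rationals is their closure; so \<open>\<rat>\<^sub>p\<close>, \<open>\<int>\<^sub>p\<close> and the elements algebraic
  over \<open>\<rat>\<^sub>p\<close> are realised as subsets of the ambient field.
\<close>

definition padic_rats :: "'a::{field_char_0, metric_space} set"
  where "padic_rats = closure \<rat>"

definition padic_ints :: "'a::{field_char_0, metric_space} set"
  where "padic_ints = closure \<int>"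

definition padic_algebraic :: "'a::{field_char_0, metric_space} set"
  where "padic_algebraic =
    {x. \<exists>f. f \<noteq> 0 \<and> (\<forall>i. coeff f i \<in> padic_rats) \<and> poly f x = 0}"

text \<open>
  \<open>\<complex>\<^sub>p\<close>, determined up to isometric isomorphism: a complete non-archimedean valued field with
  \<open>\<bar>p\<bar> = 1/p\<close> in which the elements algebraic over \<open>\<rat>\<^sub>p\<close> form an algebraically closed field
  (hence an algebraic closure of \<open>\<rat>\<^sub>p\<close>) that is dense. Completeness and characteristic 0 are
  part of the sort constraint.
\<close>

locale complex_padic_field =
  fixes p :: nat
    and absp :: "'a::{field_char_0, complete_space} \<Rightarrow> real"
  assumes prime_p: "prime p"
    and dist_absp: "dist x y = absp (x - y)"
    and absp_mult: "absp (x * y) = absp x * absp y"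
    and absp_ultrametric: "absp (x + y) \<le> max (absp x) (absp y)"
    and absp_p: "absp (of_nat p) = 1 / real p"
    and algebraic_closed: "\<lbrakk>degree (f :: 'a poly) > 0; \<And>i. coeff f i \<in> padic_algebraic\<rbrakk>
          \<Longrightarrow> \<exists>x\<in>padic_algebraic. poly f x = 0"
    and algebraic_dense: "closure (padic_algebraic :: 'a set) = UNIV"

text \<open>
  \<open>q\<^sup>x\<close> for \<open>x \<in> \<int>\<^sub>p\<close>. If \<open>\<bar>1 - q\<bar> < 1\<close>, a continuous extension of \<open>m \<mapsto> q\<^sup>m\<close> exists, and
  it is unique on \<open>\<int>\<^sub>p\<close> because \<open>\<int>\<close> is dense there; values outside \<open>\<int>\<^sub>p\<close> are arbitrary.
\<close>

definition padic_power :: "'a::{field_char_0, metric_space} \<Rightarrow> 'a \<Rightarrow> 'a"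
  where "padic_power q =
    (SOME f. continuous_on padic_ints f \<and> (\<forall>m::int. f (of_int m) = q powi m))"

definition q_num :: "'a::{field_char_0, metric_space} \<Rightarrow> 'a \<Rightarrow> 'a"
  where "q_num q x = (1 - padic_power q x) / (1 - q)"

text \<open>This is \<open>[x]\<close> to the base \<open>1/q\<close>.\<close>

definition q_num_inv :: "'a::{field_char_0, metric_space} \<Rightarrow> 'a \<Rightarrow> 'a"
  where "q_num_inv q x = (1 - padic_power q (- x)) / (1 - inverse q)"

definition q_fact :: "'a::{field_char_0, metric_space} \<Rightarrow> nat \<Rightarrow> 'a"
  where "q_fact q m = (\<Prod>i=1..m. q_num q (of_nat i))"

text \<open>Only meant for \<open>m \<le> n\<close>.\<close>

definition q_binomial :: "'a::{field_char_0, metric_space} \<Rightarrow> nat \<Rightarrow> nat \<Rightarrow> 'a"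
  where "q_binomial q n m = q_fact q n / (q_fact q (n - m) * q_fact q m)"

definition q_falling :: "'a::{field_char_0, metric_space} \<Rightarrow> 'a \<Rightarrow> nat \<Rightarrow> 'a"
  where "q_falling q x n = (\<Prod>j<n. q_num q (x - of_nat j))"

text \<open>
  The coefficients are unique when \<open>q\<close> is not a root of unity, since \<open>q_num q\<close> then takes
  infinitely many values on \<open>\<int>\<^sub>p\<close>; they are set to 0 for \<open>k > n\<close>.
\<close>

definition q_stirling1 :: "'a::{field_char_0, metric_space} \<Rightarrow> nat \<Rightarrow> nat \<Rightarrow> 'a"
  where "q_stirling1 q n =
    (THE s. (\<forall>x\<in>padic_ints. q ^ (n choose 2) * q_falling q x n = (\<Sum>k\<le>n. s k * q_num q x ^ k))
          \<and> (\<forall>k>n. s k = 0))"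

definition q_bernstein :: "nat \<Rightarrow> nat \<Rightarrow> 'a::{field_char_0, metric_space} \<Rightarrow> 'a \<Rightarrow> 'a"
  where "q_bernstein k n x q =
    of_nat (n choose k) * q_num q x ^ k * q_num_inv q (1 - x) ^ (n - k)"

end

theory Submission
  imports Defs
begin

text \<open>
  The factor \<open>[x]\<^sup>k [1-x]\<^sup>n\<^sup>-\<^sup>k\<close> is common to both sides, so the claim is the scalar identity
  \<open>(n choose k) = (\<Sum>m=k..n. (q-1)\<^sup>m\<^sup>-\<^sup>k (n choose m)\<^sub>q S\<^sub>1(m,k))\<close>. It is the comparison of the
  coefficients of \<open>X\<^sup>k\<close> in two expansions of \<open>(1 + (q-1) X)\<^sup>n\<close>. The ordinary binomial theorem gives
  \<open>(n choose k) (q-1)\<^sup>k\<close> (\<open>coeff_linear_poly_power\<close>). For the other, the q-binomial theorem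
  \<open>z\<^sup>n = (\<Sum>m\<le>n. (n choose m)\<^sub>q (\<Prod>j<m. z - q\<^sup>j))\<close> (\<open>power_eq_sum_q_binomial\<close>) is taken at
  \<open>z = 1 + (q-1) X\<close>, where \<open>z - q\<^sup>j = (q-1) (X - [j])\<close>; the products become the polynomials whose
  coefficients are the q-Stirling numbers.

  The last assertion is where p-adic analysis enters, because the q-Stirling numbers are described
  through the values \<open>[x]\<close> for all p-adic integers \<open>x\<close>. It rests on
  \<open>q\<^sup>j [x - j] = [x] - [j]\<close>, hence on \<open>q\<^sup>x = q\<^sup>j q\<^bsup>x-j\<^esup>\<close>, which follows by continuity from the case of
  integers \<open>x\<close> (\<open>padic_power_diff_of_nat\<close>). That the continuous map \<open>x \<mapsto> q\<^sup>x\<close> exists at all must be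
  shown too: \<open>m \<mapsto> q\<^sup>m\<close> is uniformly continuous on the integers for the p-adic metric, because
  \<open>q\<close> raised to \<open>p\<^sup>N\<close> converges to \<open>1\<close> (\<open>absp_power_prime_power_minus_1_le\<close>). Uniqueness of
  the coefficients (\<open>q_stirling1_eq_coeff\<close>) holds since \<open>q\<close> is not a root of unity, so that the
  values \<open>[0], [1], [2], \<dots>\<close> are pairwise distinct.
\<close>

section \<open>The absolute value\<close>

context complex_padic_field
begin

lemma absp_nonneg: "absp x \<ge> 0"
  using dist_absp[of x 0] zero_le_dist[of x 0] by simp

lemma absp_zero [simp]: "absp 0 = 0"
  using dist_absp[of 0 0] by simp

lemma p_gt_1: "p > 1"
  using prime_p by (rule prime_gt_1_nat)

lemma absp_one [simp]: "absp 1 = 1"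
  using absp_mult[of "of_nat p" 1] absp_p p_gt_1 by simp

lemma absp_minus [simp]: "absp (- x) = absp x"
  using dist_absp[of 0 x] dist_absp[of x 0] by (simp add: dist_commute)

lemma absp_minus_commute: "absp (x - y) = absp (y - x)"
  using absp_minus[of "x - y"] by simp

lemma absp_power: "absp (x ^ n) = absp x ^ n"
  by (induction n) (simp_all add: absp_mult)

lemma absp_sum_le:
  assumes "\<And>i. i \<in> A \<Longrightarrow> absp (f i) \<le> b" and "b \<ge> 0"
  shows "absp (\<Sum>i\<in>A. f i) \<le> b"
  using assms(1)
proof (induction A rule: infinite_finite_induct)
  case (insert i A)
  then show ?case
    using absp_ultrametric[of "f i" "\<Sum>i\<in>A. f i"] by fastforce
qed (use assms(2) in auto)

lemma absp_of_nat_le_1: "absp (of_nat n) \<le> 1"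
proof (induction n)
  case (Suc n)
  then show ?case using absp_ultrametric[of 1 "of_nat n"] by simp
qed simp

lemma absp_of_int_le_1: "absp (of_int m) \<le> 1"
  by (cases m rule: int_cases2) (simp_all add: absp_of_nat_le_1)

text \<open>
  A Bezout relation \<open>1 = u m + v p\<close> forces \<open>\<bar>m\<bar> = 1\<close> for \<open>m\<close> prime to \<open>p\<close>, since
  \<open>\<bar>v p\<bar> < 1\<close>; together with \<open>\<bar>p\<bar> = 1/p\<close> this makes smallness of an integer mean divisibility
  by a high power of \<open>p\<close>.
\<close>

lemma absp_of_int_not_dvd:
  assumes "\<not> int p dvd m"
  shows "absp (of_int m) = 1"
proof -
  have "coprime m (int p)"
    using assms prime_p prime_imp_coprime[of "int p" m] by (simp add: coprime_commute)
  then obtain u v where "u * m + v * int p = 1"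
    using bezout_int[of m "int p"] by auto
  then have "(of_int (u * m + v * int p) :: 'a) = 1"
    by simp
  then have eq: "of_int u * of_int m + of_int v * of_nat p = (1 :: 'a)"
    by simp
  have "absp (of_int v * of_nat p) \<le> 1 / real p"
    using absp_of_int_le_1[of v] by (simp add: absp_mult absp_p divide_right_mono)
  also have "\<dots> < 1"
    using p_gt_1 by simp
  finally have "absp (of_int v * of_nat p) < 1" .
  then have "1 \<le> absp (of_int u * of_int m)"
    using absp_ultrametric[of "of_int u * of_int m" "of_int v * of_nat p"] by (simp add: eq)
  also have "\<dots> \<le> 1 * absp (of_int m)"
    unfolding absp_mult by (intro mult_right_mono absp_of_int_le_1 absp_nonneg)
  finally show ?thesis
    using absp_of_int_le_1[of m] by simp
qed

lemma small_int_imp_prime_power_dvd: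
  assumes "absp (of_int m) < (1 / real p) ^ N"
  shows "int p ^ Suc N dvd m"
  using assms
proof (induction N arbitrary: m)
  case 0
  then show ?case using absp_of_int_not_dvd[of m] by fastforce
next
  case (Suc N)
  have "(1 / real p) ^ Suc N \<le> 1"
    using p_gt_1 by (intro power_le_one) auto
  then have "int p dvd m"
    using absp_of_int_not_dvd[of m] Suc.prems by fastforce
  then obtain t where t: "m = int p * t" ..
  have "absp (of_int m) = 1 / real p * absp (of_int t)"
    by (simp add: t absp_mult absp_p)
  then have "absp (of_int t) < (1 / real p) ^ N"
    using Suc.prems p_gt_1 mult_less_cancel_left_pos[of "1 / real p" "absp (of_int t)"] by simp
  then have "int p ^ Suc N dvd t"
    by (rule Suc.IH)
  then show ?case
    using mult_dvd_mono[of "int p" "int p"] by (simp add: t)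
qed

section \<open>Powers with p-adic exponents\<close>

lemma absp_eq_1_of_near_1:
  assumes "absp (1 - q) < 1"
  shows "absp q = 1"
  using absp_ultrametric[of q "1 - q"] absp_ultrametric[of "q - 1" 1] assms
  by (simp add: absp_minus_commute[of q 1])

lemma absp_power_minus_1_le:
  assumes "absp z = 1"
  shows "absp (z ^ n - 1) \<le> absp (z - 1)"
proof -
  have "absp (\<Sum>i<n. z ^ i) \<le> 1"
    by (rule absp_sum_le) (simp_all add: absp_power assms)
  then have "absp (z - 1) * absp (\<Sum>i<n. z ^ i) \<le> absp (z - 1)"
    using mult_left_mono[OF _ absp_nonneg] by fastforce
  then show ?thesis
    by (simp add: power_diff_1_eq absp_mult)
qed

lemma absp_power_int_minus_1_le:
  assumes "absp z = 1"
  shows "absp (z powi m - 1) \<le> absp (z - 1)"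
proof -
  have nz: "z \<noteq> 0"
    using assms by auto
  show ?thesis
  proof (cases m rule: int_cases2)
    case (nonneg n)
    then show ?thesis using absp_power_minus_1_le[OF assms] by simp
  next
    case (nonpos n)
    have "absp (z powi m - 1) = absp (z ^ n) * absp (z powi m - 1)"
      by (simp add: absp_power assms)
    also have "\<dots> = absp (z ^ n * (z powi m - 1))"
      by (simp add: absp_mult)
    also have "z ^ n * (z powi m - 1) = 1 - z ^ n"
      using nz by (simp add: nonpos power_int_minus field_simps)
    finally show ?thesis
      using absp_power_minus_1_le[OF assms, of n] by (simp add: absp_minus_commute)
  qed
qed

text \<open>
  In \<open>z\<^sup>p - 1 = (z - 1) (1 + z + \<dots> + z\<^bsup>p-1\<^esup>)\<close> the second factor is \<open>p\<close> plus terms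
  \<open>z\<^sup>i - 1\<close>, each at most as large as \<open>z - 1\<close>. When \<open>\<bar>z - 1\<bar> < 1\<close>, raising to the power \<open>p\<close>
  therefore contracts the distance to \<open>1\<close>, and the contraction factor does not deteriorate on
  iteration.
\<close>

lemma absp_power_p_minus_1_le:
  assumes "absp z = 1"
  shows "absp (z ^ p - 1) \<le> absp (z - 1) * max (absp (z - 1)) (1 / real p)"
proof -
  let ?c = "max (absp (z - 1)) (1 / real p)"
  have "absp (\<Sum>i<p. z ^ i - 1) \<le> absp (z - 1)"
    by (rule absp_sum_le) (simp_all add: absp_power_minus_1_le assms absp_nonneg)
  moreover have "(\<Sum>i<p. z ^ i) = (\<Sum>i<p. z ^ i - 1) + of_nat p"
    by (simp add: sum_subtractf)
  ultimately have "absp (\<Sum>i<p. z ^ i) \<le> ?c"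
    using absp_ultrametric[of "\<Sum>i<p. z ^ i - 1" "of_nat p"] absp_p by fastforce
  then show ?thesis
    unfolding power_diff_1_eq absp_mult by (intro mult_left_mono absp_nonneg)
qed

lemma absp_power_prime_power_minus_1_le:
  assumes "absp (1 - q) < 1"
  defines "c \<equiv> max (absp (1 - q)) (1 / real p)"
  shows "absp (q ^ (p ^ N) - 1) \<le> c ^ Suc N"
proof (induction N)
  case 0
  show ?case by (simp add: c_def absp_minus_commute[of q 1])
next
  case (Suc N)
  let ?z = "q ^ (p ^ N)"
  have c: "0 \<le> c" "c \<le> 1"
    using assms(1) p_gt_1 by (auto simp: c_def le_max_iff_disj)
  have q1: "absp q = 1"
    by (rule absp_eq_1_of_near_1) fact
  have z1: "absp ?z = 1"
    by (simp add: absp_power q1)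
  have "absp (?z - 1) \<le> c"
    using absp_power_minus_1_le[OF q1] by (simp add: c_def absp_minus_commute[of q 1] le_max_iff_disj)
  then have "max (absp (?z - 1)) (1 / real p) \<le> c"
    by (simp add: c_def)
  moreover have "0 \<le> max (absp (?z - 1)) (1 / real p)"
    by (simp add: le_max_iff_disj)
  ultimately have "absp (?z - 1) * max (absp (?z - 1)) (1 / real p) \<le> c ^ Suc N * c"
    using Suc.IH c(1) by (intro mult_mono zero_le_power)
  then have "absp (?z ^ p - 1) \<le> c ^ Suc N * c"
    using absp_power_p_minus_1_le[OF z1] by (rule order_trans[rotated])
  then show ?case
    by (simp add: power_mult [symmetric] mult.commute)
qed

lemma power_int_uniformly_continuous:
  assumes q: "absp (1 - q) < 1" and e: "e > 0"
  obtains d where "d > 0"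
    "\<And>a b :: int. absp (of_int a - of_int b) < d \<Longrightarrow> absp (q powi a - q powi b) < e"
proof -
  define c where "c = max (absp (1 - q)) (1 / real p)"
  have c: "0 \<le> c" "c < 1"
    using q p_gt_1 by (auto simp: c_def le_max_iff_disj)
  obtain N where N: "c ^ N < e"
    using real_arch_pow_inv[OF e c(2)] by blast
  have q1: "absp q = 1"
    by (rule absp_eq_1_of_near_1) fact
  have nz: "q \<noteq> 0"
    using q1 by auto
  show thesis
  proof
    show "(1 / real p) ^ N > 0"
      using p_gt_1 by simp
  next
    fix a b :: int
    assume "absp (of_int a - of_int b) < (1 / real p) ^ N"
    then have "int p ^ Suc N dvd a - b"
      by (intro small_int_imp_prime_power_dvd) simp
    then obtain t where t: "a = b + int (p ^ Suc N) * t"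
      by (metis dvd_def add_diff_cancel_left' diff_add_cancel of_nat_power add.commute)
    \<comment> \<open>With \<open>a - b\<close> a multiple of a high power of \<open>p\<close>, the ratio of the two powers of \<open>q\<close> is a power
       of \<open>z\<close>, which is at least as close to \<open>1\<close> as \<open>z\<close> itself.\<close>
    let ?z = "q ^ (p ^ Suc N)"
    have "q powi a = q powi b * ?z powi t"
      using nz by (simp only: t power_int_add power_int_mult power_int_of_nat simp_thms)
    then have "q powi a - q powi b = q powi b * (?z powi t - 1)"
      by (simp add: algebra_simps)
    moreover have "absp (q powi b) = 1"
      using absp_power_int_minus_1_le[OF q1, of b] q
      by (intro absp_eq_1_of_near_1) (simp add: absp_minus_commute[of _ 1])
    moreover have "absp (?z powi t - 1) \<le> absp (?z - 1)"
      by (rule absp_power_int_minus_1_le) (simp add: absp_power q1)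
    moreover have "absp (?z - 1) \<le> c ^ Suc (Suc N)"
      unfolding c_def by (rule absp_power_prime_power_minus_1_le) fact
    moreover have "c ^ Suc (Suc N) \<le> c ^ N"
      using c by (intro power_decreasing) auto
    ultimately show "absp (q powi a - q powi b) < e"
      using N by (simp add: absp_mult)
  qed
qed

text \<open>
  A uniformly continuous map into a complete space extends to the closure of its domain, so the
  description defining \<^const>\<open>padic_power\<close> is satisfiable and may be used.
\<close>

lemma padic_power_extends:
  assumes q: "absp (1 - q) < 1"
  shows continuous_on_padic_power: "continuous_on padic_ints (padic_power q)"
    and padic_power_of_int: "\<And>m. padic_power q (of_int m) = q powi m"
proof -
  \<comment> \<open>The exponent is recovered from its image in the field; it is unique in characteristic 0.\<close>
  define f :: "'a \<Rightarrow> 'a" where "f x = q powi (THE m. of_int m = x)" for x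
  have f: "f (of_int m) = q powi m" for m
    by (simp add: f_def)
  have "uniformly_continuous_on \<int> f"
    unfolding uniformly_continuous_on_def
  proof (intro allI impI)
    fix e :: real
    assume "e > 0"
    then obtain d where d: "d > 0"
      "\<And>a b :: int. absp (of_int a - of_int b) < d \<Longrightarrow> absp (q powi a - q powi b) < e"
      using power_int_uniformly_continuous[OF q] by blast
    show "\<exists>d>0. \<forall>x\<in>\<int>. \<forall>x'\<in>\<int>. dist x' x < d \<longrightarrow> dist (f x') (f x) < e"
    proof (intro exI conjI ballI impI)
      fix x x' :: 'a
      assume "x \<in> \<int>" "x' \<in> \<int>" "dist x' x < d"
      then show "dist (f x') (f x) < e"
        by (auto elim!: Ints_cases simp: f dist_absp d(2))
    qed (fact d(1))
  qed
  then obtain g where g: "uniformly_continuous_on (closure \<int>) g" "\<And>x. x \<in> \<int> \<Longrightarrow> f x = g x"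
    by (rule uniformly_continuous_on_extension_on_closure) (rule that)
  let ?P = "\<lambda>h. continuous_on padic_ints h \<and> (\<forall>m::int. h (of_int m) = q powi m)"
  have "?P g"
    using g(2)[OF Ints_of_int] uniformly_continuous_imp_continuous[OF g(1)]
    by (auto simp: padic_ints_def f)
  then have *: "?P (padic_power q)"
    unfolding padic_power_def by (rule someI[where P = ?P])
  show "continuous_on padic_ints (padic_power q)"
    using * by blast
  show "padic_power q (of_int m) = q powi m" for m
    using * by blast
qed

lemma padic_power_of_nat:
  assumes "absp (1 - q) < 1"
  shows "padic_power q (of_nat m) = q ^ m"
  using padic_power_of_int[OF assms, of "int m"] by simp

text \<open>
  The functional equation holds for integers \<open>x\<close>, and both sides are continuous in \<open>x\<close>; the
  limits are taken along a sequence of integers because the ambient type carries a metric but no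
  built-in continuity of the field operations.
\<close>

lemma padic_power_diff_of_nat:
  assumes q: "absp (1 - q) < 1" and x: "x \<in> padic_ints"
  shows "padic_power q x = q ^ j * padic_power q (x - of_nat j)"
proof -
  have q1: "absp q = 1"
    by (rule absp_eq_1_of_near_1) fact
  then have nz: "q \<noteq> 0"
    by auto
  from x obtain u where u: "\<And>n. u n \<in> \<int>" "u \<longlonglongrightarrow> x"
    unfolding padic_ints_def closure_sequential by blast
  have shift: "(\<lambda>n. u n - of_nat j) \<longlonglongrightarrow> x - of_nat j"
    using u(2) by (simp add: tendsto_iff dist_absp)
  have mem: "u n \<in> padic_ints" "u n - of_nat j \<in> padic_ints" for n
    using u(1)[of n] closure_subset[of "\<int> :: 'a set"] by (auto simp: padic_ints_def)
  have mem_x: "x - of_nat j \<in> padic_ints"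
    unfolding padic_ints_def closure_sequential
    using shift u(1) by (intro exI[of _ "\<lambda>n. u n - of_nat j"]) simp
  have lim: "(\<lambda>n. padic_power q (v n)) \<longlonglongrightarrow> padic_power q y"
    if "\<And>n. v n \<in> padic_ints" "y \<in> padic_ints" "v \<longlonglongrightarrow> y" for v y
    using continuous_on_padic_power[OF q] that
    by (auto simp: continuous_on_sequentially comp_def)
  have "(\<lambda>n. q ^ j * padic_power q (u n - of_nat j)) \<longlonglongrightarrow> q ^ j * padic_power q (x - of_nat j)"
    using lim[OF mem(2) mem_x shift]
    by (simp add: tendsto_iff dist_absp right_diff_distrib [symmetric] absp_mult absp_power q1)
  moreover have "q ^ j * padic_power q (u n - of_nat j) = padic_power q (u n)" for n
  proof -
    obtain m where m: "u n = of_int m"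
      using u(1)[of n] by (auto elim: Ints_cases)
    have "padic_power q (u n - of_nat j) = padic_power q (of_int (m - int j))"
      by (simp add: m)
    also have "\<dots> = q powi m / q ^ j"
      using nz by (simp add: padic_power_of_int[OF q] power_int_diff del: of_int_diff)
    finally show ?thesis
      using nz by (simp add: m padic_power_of_int[OF q])
  qed
  ultimately have "(\<lambda>n. padic_power q (u n)) \<longlonglongrightarrow> q ^ j * padic_power q (x - of_nat j)"
    by simp
  then show ?thesis
    using lim[OF mem(1) x u(2)] by (rule LIMSEQ_unique[rotated])
qed

end

section \<open>The q-Stirling numbers as coefficients\<close>

definition q_falling_poly :: "'a::{field_char_0, metric_space} \<Rightarrow> nat \<Rightarrow> 'a poly"
  where "q_falling_poly q n = (\<Prod>j<n. [:- q_num q (of_nat j), 1:])"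

lemma degree_q_falling_poly: "degree (q_falling_poly q n) = n"
  unfolding q_falling_poly_def by (subst degree_prod_eq_sum_degree) auto

lemma poly_q_falling_poly: "poly (q_falling_poly q n) z = (\<Prod>j<n. z - q_num q (of_nat j))"
  by (simp add: q_falling_poly_def poly_prod)

lemma poly_eq_sum_atMost:
  fixes f :: "'a::comm_semiring_1 poly"
  assumes "degree f \<le> n"
  shows "poly f z = (\<Sum>k\<le>n. coeff f k * z ^ k)"
  unfolding poly_altdef using assms
  by (intro sum.mono_neutral_left) (auto simp: coeff_eq_0)

locale padic_q_base = complex_padic_field p absp
  for p and absp :: "'a::{field_char_0, complete_space} \<Rightarrow> real" +
  fixes q :: 'a
  assumes near_1: "absp (1 - q) < 1"
    and not_root_of_unity: "m > 0 \<Longrightarrow> q ^ m \<noteq> 1"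
begin

lemma q_neq_1: "q \<noteq> 1"
  using not_root_of_unity[of 1] by simp

lemma q_neq_0: "q \<noteq> 0"
  using absp_eq_1_of_near_1[OF near_1] by auto

lemma q_num_of_nat: "q_num q (of_nat m) = (1 - q ^ m) / (1 - q)"
  by (simp add: q_num_def padic_power_of_nat[OF near_1])

lemma q_num_of_nat_neq_0: "m > 0 \<Longrightarrow> q_num q (of_nat m) \<noteq> 0"
  using not_root_of_unity[of m] q_neq_1 by (simp add: q_num_of_nat)

lemma inj_q_num_of_nat: "inj (\<lambda>m. q_num q (of_nat m))"
proof (rule linorder_injI)
  fix m n :: nat
  assume "m < n"
  then have "q ^ n = q ^ m * q ^ (n - m)"
    by (simp flip: power_add)
  then have "q ^ n \<noteq> q ^ m"
    using not_root_of_unity[of "n - m"] \<open>m < n\<close> q_neq_0 by auto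
  then show "q_num q (of_nat m) \<noteq> q_num q (of_nat n)"
    using q_neq_1 by (auto simp: q_num_of_nat)
qed

lemma q_num_diff_of_nat:
  assumes "x \<in> padic_ints"
  shows "q ^ j * q_num q (x - of_nat j) = q_num q x - q_num q (of_nat j)"
proof -
  have "q ^ j * q_num q (x - of_nat j) = (q ^ j - q ^ j * padic_power q (x - of_nat j)) / (1 - q)"
    by (simp add: q_num_def right_diff_distrib)
  also have "\<dots> = (q ^ j - padic_power q x) / (1 - q)"
    by (simp only: padic_power_diff_of_nat[OF near_1 assms, of j])
  also have "\<dots> = ((1 - padic_power q x) - (1 - q ^ j)) / (1 - q)"
    by simp
  also have "\<dots> = q_num q x - q_num q (of_nat j)"
    by (simp only: q_num_of_nat) (simp only: q_num_def diff_divide_distrib)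
  finally show ?thesis .
qed

lemma q_falling_eq_poly:
  assumes "x \<in> padic_ints"
  shows "q ^ (n choose 2) * q_falling q x n = poly (q_falling_poly q n) (q_num q x)"
proof -
  have "n choose 2 = (\<Sum>j<n. j)"
    by (induction n) (auto simp: numeral_2_eq_2)
  then have "q ^ (n choose 2) = (\<Prod>j<n. q ^ j)"
    by (simp add: power_sum)
  then show ?thesis
    by (simp add: q_falling_def poly_q_falling_poly q_num_diff_of_nat[OF assms] flip: prod.distrib)
qed

text \<open>
  Two coefficient families satisfying the defining condition give polynomials that agree at the
  infinitely many points \<open>[0], [1], [2], \<dots>\<close>, so the description defining
  \<^const>\<open>q_stirling1\<close> picks out the coefficients of \<open>\<Prod>j<n. X - [j]\<close>.
\<close>

lemma q_stirling1_eq_coeff: "q_stirling1 q n = coeff (q_falling_poly q n)"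
  unfolding q_stirling1_def
proof (rule the_equality, intro conjI ballI allI impI)
  fix x :: 'a
  assume "x \<in> padic_ints"
  then show "q ^ (n choose 2) * q_falling q x n
      = (\<Sum>k\<le>n. coeff (q_falling_poly q n) k * q_num q x ^ k)"
    using poly_eq_sum_atMost[of "q_falling_poly q n" n]
    by (simp add: q_falling_eq_poly degree_q_falling_poly)
next
  fix k
  assume "k > n"
  then show "coeff (q_falling_poly q n) k = 0"
    by (simp add: coeff_eq_0 degree_q_falling_poly)
next
  fix s
  assume s: "(\<forall>x\<in>padic_ints. q ^ (n choose 2) * q_falling q x n = (\<Sum>k\<le>n. s k * q_num q x ^ k))
    \<and> (\<forall>k>n. s k = 0)"
  define f where "f = (\<Sum>k\<le>n. monom (s k) k)"
  have coeff_f: "coeff f k = s k" for k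
    using s by (auto simp: f_def coeff_sum)
  have poly_f: "poly f z = (\<Sum>k\<le>n. s k * z ^ k)" for z
    by (simp add: f_def poly_sum poly_monom)
  have "poly (f - q_falling_poly q n) (q_num q (of_nat m)) = 0" for m
  proof -
    have "(of_nat m :: 'a) \<in> padic_ints"
      using closure_subset[of "\<int> :: 'a set"] by (auto simp: padic_ints_def)
    then show ?thesis
      using s by (auto simp: poly_f simp flip: q_falling_eq_poly)
  qed
  then have "range (\<lambda>m. q_num q (of_nat m)) \<subseteq> {z. poly (f - q_falling_poly q n) z = 0}"
    by auto
  moreover have "infinite (range (\<lambda>m. q_num q (of_nat m)))"
    using inj_q_num_of_nat by (rule range_inj_infinite)
  ultimately have "f - q_falling_poly q n = 0"
    using poly_roots_finite finite_subset by blast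
  then show "s = coeff (q_falling_poly q n)"
    using coeff_f by auto
qed

section \<open>The q-binomial theorem\<close>

lemma q_fact_Suc: "q_fact q (Suc m) = q_num q (of_nat (Suc m)) * q_fact q m"
  by (simp add: q_fact_def mult.commute)

lemma q_fact_neq_0: "q_fact q m \<noteq> 0"
  by (simp add: q_fact_def q_num_of_nat_neq_0 del: of_nat_Suc)

lemma q_binomial_0: "q_binomial q n 0 = 1"
  using q_fact_neq_0[of n] by (simp add: q_binomial_def q_fact_def[of q 0])

lemma q_binomial_self: "q_binomial q n n = 1"
  using q_fact_neq_0[of n] by (simp add: q_binomial_def q_fact_def[of q 0])

lemma q_binomial_Suc_Suc:
  assumes "m < n"
  shows "q_binomial q (Suc n) (Suc m) = q_binomial q n m + q ^ Suc m * q_binomial q n (Suc m)"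
proof -
  define d where "d = n - Suc m"
  have n: "n = Suc (m + d)"
    using assms by (simp add: d_def)
  let ?a = "q_num q (of_nat (Suc m))" and ?b = "q_num q (of_nat (Suc d))" and ?Q = "q ^ Suc m"
  have num: "q_num q (of_nat (Suc n)) = ?a + ?Q * ?b"
    unfolding q_num_of_nat using q_neq_1 by (simp add: n field_simps power_add)
  have diffs: "Suc n - Suc m = Suc d" "n - m = Suc d" "n - Suc m = d"
    by (simp_all add: n)
  have cancel: "(a + Q * b) * f / ((b * u) * (a * v)) = f / ((b * u) * v) + Q * (f / (u * (a * v)))"
    if "a \<noteq> 0" "b \<noteq> 0" "u \<noteq> 0" "v \<noteq> 0" for a b u v f Q :: 'a
    using that by (simp add: field_simps)
  show ?thesis
    unfolding q_binomial_def diffs q_fact_Suc num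
    by (rule cancel) (simp_all only: q_fact_neq_0 q_num_of_nat_neq_0 zero_less_Suc not_False_eq_True)
qed

text \<open>
  Induction on \<open>n\<close>: split the new factor as \<open>z = (z - q\<^sup>m) + q\<^sup>m\<close> in the \<open>m\<close>-th term, where the
  first part lengthens the product and the second keeps it, and collect with the q-Pascal rule.
\<close>

lemma power_eq_sum_q_binomial:
  "z ^ n = (\<Sum>m\<le>n. q_binomial q n m * (\<Prod>j<m. z - q ^ j))"
proof (induction n)
  case 0
  show ?case by (simp add: q_binomial_0)
next
  case (Suc n)
  let ?P = "\<lambda>m. \<Prod>j<m. z - q ^ j"
  let ?b = "q_binomial q n"
  have split: "?b m * ?P m * z = ?b m * ?P (Suc m) + q ^ m * ?b m * ?P m" for m
    by (simp add: algebra_simps)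
  have "z ^ Suc n = (\<Sum>m\<le>n. ?b m * ?P m * z)"
    by (simp only: power_Suc2 Suc.IH sum_distrib_right)
  also have "\<dots> = (\<Sum>m\<le>n. ?b m * ?P (Suc m)) + (\<Sum>m\<le>n. q ^ m * ?b m * ?P m)"
    by (simp only: split sum.distrib)
  also have "(\<Sum>m\<le>n. ?b m * ?P (Suc m)) = (\<Sum>m<n. ?b m * ?P (Suc m)) + ?P (Suc n)"
    by (simp add: q_binomial_self flip: lessThan_Suc_atMost)
  also have "(\<Sum>m\<le>n. q ^ m * ?b m * ?P m)
      = 1 + (\<Sum>m<n. q ^ Suc m * ?b (Suc m) * ?P (Suc m))"
    by (simp only: sum.atMost_shift) (simp add: q_binomial_0)
  also have "(\<Sum>m<n. ?b m * ?P (Suc m)) + ?P (Suc n)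
        + (1 + (\<Sum>m<n. q ^ Suc m * ?b (Suc m) * ?P (Suc m)))
      = 1 + (\<Sum>m<n. q_binomial q (Suc n) (Suc m) * ?P (Suc m)) + ?P (Suc n)"
    by (simp add: q_binomial_Suc_Suc algebra_simps sum.distrib del: prod.lessThan_Suc power_Suc)
  also have "\<dots> = (\<Sum>m\<le>Suc n. q_binomial q (Suc n) m * ?P m)"
    by (simp only: sum.atMost_shift sum.lessThan_Suc) (simp add: q_binomial_0 q_binomial_self)
  finally show ?case .
qed

text \<open>
  The substitution \<open>z = 1 + (q - 1) X\<close> turns each factor \<open>z - q\<^sup>j\<close> into \<open>(q - 1) (X - [j])\<close>, so
  the q-binomial theorem becomes an expansion of the ordinary power \<open>(1 + (q - 1) X)\<^sup>n\<close> in the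
  polynomials that generate the q-Stirling numbers.
\<close>

lemma linear_power_eq_sum_q_falling_poly:
  "[:1, q - 1:] ^ n = (\<Sum>m\<le>n. smult ((q - 1) ^ m * q_binomial q n m) (q_falling_poly q m))"
proof -
  have factor: "1 + y * (q - 1) - q ^ j = (q - 1) * (y - q_num q (of_nat j))" for y j
    using q_neq_1 by (simp add: q_num_of_nat field_simps)
  have "poly ([:1, q - 1:] ^ n) y
      = poly (\<Sum>m\<le>n. smult ((q - 1) ^ m * q_binomial q n m) (q_falling_poly q m)) y" for y
    using power_eq_sum_q_binomial[of "1 + y * (q - 1)" n]
    by (simp add: factor poly_sum poly_q_falling_poly prod.distrib mult_ac)
  then show ?thesis
    unfolding poly_eq_poly_eq_iff [symmetric] by blast
qed

lemma binomial_eq_sum_q_binomial_q_stirling1: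
  "of_nat (n choose k) = (\<Sum>m=k..n. (q - 1) ^ (m - k) * q_binomial q n m * q_stirling1 q m k)"
proof -
  \<comment> \<open>The exponent \<open>m - k\<close> is a truncated difference, so the common factor \<open>(q - 1)\<^sup>k\<close> can be
     extracted only after the vanishing terms with \<open>m < k\<close> are dropped.\<close>
  have "(q - 1) ^ k * of_nat (n choose k) = coeff ([:1, q - 1:] ^ n) k"
  proof (cases "k \<le> n")
    case True
    then show ?thesis by (simp add: coeff_linear_poly_power)
  next
    case False
    then have "degree ([:1, q - 1:] ^ n) < k"
      using degree_power_le[of "[:1, q - 1:]" n] q_neq_1 by simp
    then show ?thesis using False by (simp add: coeff_eq_0)
  qed
  also have "\<dots> = (\<Sum>m\<le>n. (q - 1) ^ m * q_binomial q n m * q_stirling1 q m k)"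
    by (simp add: linear_power_eq_sum_q_falling_poly coeff_sum q_stirling1_eq_coeff)
  also have "\<dots> = (\<Sum>m=k..n. (q - 1) ^ m * q_binomial q n m * q_stirling1 q m k)"
    by (intro sum.mono_neutral_right)
      (auto simp: q_stirling1_eq_coeff coeff_eq_0 degree_q_falling_poly)
  also have "\<dots> = (q - 1) ^ k
      * (\<Sum>m=k..n. (q - 1) ^ (m - k) * q_binomial q n m * q_stirling1 q m k)"
    by (auto simp: sum_distrib_left mult.assoc simp flip: power_add intro!: sum.cong)
  finally show ?thesis
    using q_neq_1 by simp
qed

end

theorem proposition4:
  fixes p n k :: nat
    and absp :: "'a::{field_char_0, complete_space} \<Rightarrow> real"
    and q x :: 'a
  assumes "complex_padic_field p absp"
    and "absp (1 - q) < 1"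
    and "\<forall>m>0. q ^ m \<noteq> 1"
    and "x \<in> padic_ints"
  shows "q_bernstein k n x q =
           of_nat (n choose k) * q_num q x ^ k * q_num_inv q (1 - x) ^ (n - k)
       \<and> of_nat (n choose k) * q_num q x ^ k * q_num_inv q (1 - x) ^ (n - k) =
           (\<Sum>m=k..n. (q - 1) ^ (m - k) * q_binomial q n m * q_stirling1 q m k
                       * q_num q x ^ k * q_num_inv q (1 - x) ^ (n - k))"
proof -
  interpret padic_q_base p absp q
    using assms by (simp add: padic_q_base_def padic_q_base_axioms_def)
  show ?thesis
    by (simp only: q_bernstein_def binomial_eq_sum_q_binomial_q_stirling1 sum_distrib_right)
qed

end
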